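(* Suppose that $\tau,\sigma$ are complex numbers with positive imaginary part. Then $u(z)=\Gamma(z,\tau,\sigma)$ is the unique meromorphic solution (on $\mathbb{C}$) of the difference equation \[ u(z+\sigma)=\theta_0(z,\tau)\,u(z) \] such that: (i) $u(z)$ obeys $u(z+1)=u(z)$ and is holomorphic on the upper half plane $\mathrm{Im}\,z>0$; (ii) $u((\tau+\sigma)/2)=1$.
   Context: For $z,\tau,\sigma\in\mathbb{C}$ with $\mathrm{Im}\,\tau>0$, $\mathrm{Im}\,\sigma>0$, the elliptic gamma function is the meromorphic function \[ \Gamma(z,\tau,\sigma)=\prod_{j,k=0}^\infty\frac{1-e^{2\pi i((j+1)\tau+(k+1)\sigma-z)}}{1-e^{2\pi i(j\tau+k\sigma+z)}}, \] and the theta function is \[ \theta_0(z,\tau)=\prod_{j=0}^\infty(1-e^{2\pi i((j+1)\tau-z)})(1-e^{2\pi i(j\tau+z)}). \] *)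

theory Defs
  imports "HOL-Complex_Analysis.Complex_Analysis"
begin

(* The double product converges absolutely for Im tau > 0 and Im sigma > 0, so it may be written as
   an iterated one.  At a pole some denominator vanishes; as x / 0 = 0, the value there is 0, which
   is the library's convention for the value of a meromorphic function at a pole. *)
definition elliptic_gamma :: "complex \<Rightarrow> complex \<Rightarrow> complex \<Rightarrow> complex" where
  "elliptic_gamma z \<tau> \<sigma> =
     (\<Prod>j. \<Prod>k.
        (1 - exp (2 * of_real pi * \<i> * ((of_nat j + 1) * \<tau> + (of_nat k + 1) * \<sigma> - z))) /
        (1 - exp (2 * of_real pi * \<i> * (of_nat j * \<tau> + of_nat k * \<sigma> + z))))"

definition theta0 :: "complex \<Rightarrow> complex \<Rightarrow> complex" where
  "theta0 z \<tau> =
     (\<Prod>j. (1 - exp (2 * of_real pi * \<i> * ((of_nat j + 1) * \<tau> - z))) *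
           (1 - exp (2 * of_real pi * \<i> * (of_nat j * \<tau> + z))))"

(* The predicate nicely_meromorphic_on singles out the representative of a meromorphic function
   that has no removable singularities and takes the value 0 at its poles.  The difference equation
   is an identity of meromorphic functions and is required pointwise wherever u z is defined: at a
   pole of u the right-hand side may have a removable singularity (for the elliptic gamma function,
   theta0 vanishes and u has a pole at z = 0, whereas u is finite at sigma). *)
definition difference_equation_solution ::
    "complex \<Rightarrow> complex \<Rightarrow> (complex \<Rightarrow> complex) \<Rightarrow> bool" where
  "difference_equation_solution \<tau> \<sigma> u \<longleftrightarrow>
     u nicely_meromorphic_on UNIV \<and>
     (\<forall>z. \<not> is_pole u z \<longrightarrow> u (z + \<sigma>) = theta0 z \<tau> * u z)"

end

theory Submission
  imports Defs
begin

text \<open>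
  Write \<open>p = exp (2\<pi>i\<tau>)\<close>, \<open>q = exp (2\<pi>i\<sigma>)\<close> and \<open>x = exp (2\<pi>iz)\<close>, so that \<open>p\<close> and \<open>q\<close> lie in the open
  unit disc. The function \<open>D z = \<Prod>j k. (1 - x p^j q^k)\<close> is entire, vanishes only where \<open>Im z \<le> 0\<close>, and
  the elliptic gamma function \<open>G\<close> is \<open>D (\<tau> + \<sigma> - z) / D z\<close>. Numerator and denominator have no common
  zero, so the poles of \<open>G\<close> are exactly the zeros of \<open>D\<close>. Taking the factors with \<open>k = 0\<close> out of \<open>D\<close>
  gives \<open>D z = (x; p)\<^sub>\<infinity> D (z + \<sigma>)\<close>; applied at \<open>z\<close> and at \<open>\<tau> - z\<close>, this is the difference equation,
  because \<open>theta0 z \<tau> = (p/x; p)\<^sub>\<infinity> (x; p)\<^sub>\<infinity>\<close>. At the midpoint \<open>(\<tau> + \<sigma>)/2\<close>, the fixed point of the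
  reflection \<open>z \<mapsto> \<tau> + \<sigma> - z\<close>, the quotient is 1.

  Both \<open>(x; q)\<^sub>\<infinity>\<close> and the double product arise from the same construction, which sends an entire
  function \<open>h\<close> with \<open>h 0 = 1\<close> to \<open>\<Prod>j. h (x p^j)\<close>. The result is again entire with value 1 at 0
  (\<open>holomorphic_dilation_prod\<close>), so the construction can be iterated.

  For uniqueness, let \<open>u\<close> be another solution. In the strip \<open>0 < Im z < Im \<tau> + Im \<sigma>\<close> the function \<open>G\<close>
  has neither zeros nor poles, so \<open>u / G\<close> is holomorphic there, with periods \<open>1\<close> and \<open>\<sigma>\<close>. As
  \<open>Im \<tau> > 0\<close>, the strip contains a compact fundamental parallelogram of the period lattice, and the
  maximum modulus principle makes \<open>u / G\<close> constant (\<open>strip_constant\<close>). The normalisation makes the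
  constant 1, and the identity theorem extends \<open>u = G\<close> to the whole plane.
\<close>

section \<open>Products over a geometric progression of dilations\<close>

text \<open>
  The infinite product of the dilates of \<open>h\<close> along the geometric progression \<open>1, p, p^2, \<dots>\<close>. It is
  used for entire \<open>h\<close> with \<open>h 0 = 1\<close> and for \<open>norm p < 1\<close>, where it converges, possibly to 0.
\<close>
definition dilation_prod :: "(complex \<Rightarrow> complex) \<Rightarrow> complex \<Rightarrow> complex \<Rightarrow> complex" where
  "dilation_prod h p x = (\<Prod>j. h (x * p ^ j))"

lemma holomorphic_linear_bound_at_0:
  fixes h :: "complex \<Rightarrow> complex"
  assumes h: "h holomorphic_on UNIV" and h0: "h 0 = c"
  obtains B where "\<And>y. norm y \<le> R \<Longrightarrow> norm (h y - c) \<le> B * norm y"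
proof -
  have "continuous_on (cball 0 R) (deriv h)"
    by (meson h holomorphic_deriv holomorphic_on_imp_continuous_on holomorphic_on_subset
        open_UNIV subset_UNIV)
  then have "bounded (deriv h ` cball 0 R)"
    using compact_continuous_image compact_cball compact_imp_bounded by blast
  then obtain B where B: "\<And>y. y \<in> cball 0 R \<Longrightarrow> norm (deriv h y) \<le> B"
    unfolding bounded_iff by blast
  have "norm (h y - c) \<le> B * norm y" if y: "norm y \<le> R" for y
  proof -
    have "norm (h y - h 0) \<le> B * norm (y - 0)"
    proof (rule field_differentiable_bound[where S = "cball 0 R" and f' = "deriv h"])
      show "(h has_field_derivative deriv h z) (at z within cball 0 R)" for z
        using h holomorphic_derivI[of h UNIV z] has_field_derivative_at_within by blast
      have "0 \<le> R"
        using y norm_ge_zero order_trans by blast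
      then show "y \<in> cball 0 R" "(0::complex) \<in> cball 0 R"
        using y by auto
    qed (use B in auto)
    then show ?thesis
      by (simp add: h0)
  qed
  then show ?thesis
    using that by blast
qed

text \<open>
  A majorant for the factors that is uniform on discs: since \<open>h y = 1 + O(y)\<close>, the terms are dominated by
  a geometric series. Convergence and holomorphy of the product both rest on it.
\<close>
lemma dilation_factor_bound:
  fixes h :: "complex \<Rightarrow> complex"
  assumes h: "h holomorphic_on UNIV" "h 0 = 1" and p: "norm p < 1"
  shows "\<exists>M. summable M \<and> (\<forall>j x. norm x \<le> R \<longrightarrow> norm (h (x * p ^ j) - 1) \<le> M j)"
proof -
  obtain B where B: "\<And>y. norm y \<le> R \<Longrightarrow> norm (h y - 1) \<le> B * norm y"
    using holomorphic_linear_bound_at_0[OF h] by blast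
  define M where "M = (\<lambda>j. \<bar>B\<bar> * R * norm p ^ j)"
  have "summable M"
    unfolding M_def using p by (intro summable_mult summable_geometric) auto
  moreover have "norm (h (x * p ^ j) - 1) \<le> M j" if x: "norm x \<le> R" for x j
  proof -
    have le: "norm (x * p ^ j) \<le> R * norm p ^ j"
      using x by (simp add: norm_mult norm_power mult_right_mono)
    have "0 \<le> R"
      using x norm_ge_zero order_trans by blast
    then have "R * norm p ^ j \<le> R * 1"
      using p by (intro mult_left_mono power_le_one) auto
    with le have "norm (h (x * p ^ j) - 1) \<le> B * norm (x * p ^ j)"
      by (intro B) simp
    also have "\<dots> \<le> \<bar>B\<bar> * (R * norm p ^ j)"
      using le by (intro mult_mono) auto
    finally show ?thesis
      by (simp add: M_def mult.assoc)
  qed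
  ultimately show ?thesis
    by blast
qed

lemma convergent_prod_dilation:
  assumes "h holomorphic_on UNIV" "h 0 = 1" "norm p < 1"
  shows "convergent_prod (\<lambda>j. h (x * p ^ j))"
proof -
  obtain M where "summable M" "\<And>j y. norm y \<le> norm x \<Longrightarrow> norm (h (y * p ^ j) - 1) \<le> M j"
    using dilation_factor_bound[OF assms, of "norm x"] by blast
  then have "summable (\<lambda>j. norm (h (x * p ^ j) - 1))"
    by - (rule summable_comparison_test'[of M 0 "\<lambda>i. norm (h (x * p ^ i) - 1)"], auto)
  then show ?thesis
    by (intro abs_convergent_prod_imp_convergent_prod summable_imp_abs_convergent_prod)
qed

lemma holomorphic_dilation_prod:
  assumes h: "h holomorphic_on UNIV" "h 0 = 1" and p: "norm p < 1"
  shows "dilation_prod h p holomorphic_on UNIV"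
proof (rule holomorphic_uniform_sequence)
  let ?P = "\<lambda>N x. \<Prod>j<N. h (x * p ^ j)"
  have dil: "(\<lambda>x. h (x * p ^ j)) holomorphic_on UNIV" for j
    by (rule holomorphic_on_compose_gen[OF _ h(1), unfolded o_def])
      (auto intro!: holomorphic_intros)
  then show "(?P N) holomorphic_on UNIV" for N
    by (intro holomorphic_intros) auto
  show "\<exists>d>0. cball x d \<subseteq> UNIV \<and> uniform_limit (cball x d) ?P (dilation_prod h p) sequentially"
    for x
  proof (intro exI[of _ 1] conjI)
    let ?K = "cball x 1"
    obtain M where M: "summable M"
      "\<And>j y. norm y \<le> norm x + 1 \<Longrightarrow> norm (h (y * p ^ j) - 1) \<le> M j"
      using dilation_factor_bound[OF h p, of "norm x + 1"] by blast
    have "norm y \<le> norm x + 1" if "y \<in> ?K" for y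
      using that norm_triangle_sub[of y x] by (simp add: dist_norm norm_minus_commute)
    then have "uniformly_convergent_on ?K (\<lambda>N y. \<Sum>j<N. norm (h (y * p ^ j) - 1))"
      using M by (intro Weierstrass_m_test'[of _ _ M]) auto
    then have "uniformly_convergent_on ?K (\<lambda>N y. \<Prod>j<N. 1 + (h (y * p ^ j) - 1))"
      by (intro uniformly_convergent_on_prod continuous_intros
            holomorphic_on_imp_continuous_on holomorphic_on_subset[OF dil]) auto
    then obtain l where l: "uniform_limit ?K ?P l sequentially"
      unfolding uniformly_convergent_on_def by auto
    have "l y = dilation_prod h p y" if "y \<in> ?K" for y
    proof -
      have "(\<lambda>N. ?P N y) \<longlonglongrightarrow> l y"
        using tendsto_uniform_limitI[OF l that] .
      moreover have "(\<lambda>N. ?P N y) \<longlonglongrightarrow> dilation_prod h p y"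
        unfolding dilation_prod_def
        by (intro has_prod_imp_tendsto' convergent_prod_has_prod convergent_prod_dilation h p)
      ultimately show ?thesis
        by (rule LIMSEQ_unique)
    qed
    with l show "uniform_limit ?K ?P (dilation_prod h p) sequentially"
      by (metis (no_types, lifting) uniform_limit_cong')
  qed auto
qed auto

lemma dilation_prod_0: "h 0 = 1 \<Longrightarrow> dilation_prod h p 0 = 1"
  by (simp add: dilation_prod_def)

lemma dilation_prod_eq_0_iff:
  assumes "h holomorphic_on UNIV" "h 0 = 1" "norm p < 1"
  shows "dilation_prod h p x = 0 \<longleftrightarrow> (\<exists>j. h (x * p ^ j) = 0)"
proof -
  have "(\<lambda>j. h (x * p ^ j)) has_prod dilation_prod h p x"
    unfolding dilation_prod_def using convergent_prod_dilation[OF assms] by blast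
  from has_prod_eq_0_iff[OF this] show ?thesis
    by (auto simp: image_iff)
qed

lemma dilation_prod_step:
  assumes "h holomorphic_on UNIV" "h 0 = 1" "norm p < 1"
  shows "dilation_prod h p x = h x * dilation_prod h p (x * p)"
proof -
  have "(\<lambda>j. h (x * p ^ j)) has_prod
          ((\<Prod>j<1. h (x * p ^ j)) * (\<Prod>j. h (x * p ^ (j + 1))))"
    by (intro has_prod_ignore_initial_segment' convergent_prod_dilation assms)
  then show ?thesis
    unfolding dilation_prod_def using has_prod_unique by (fastforce simp: mult.assoc)
qed

section \<open>The double q-product\<close>

text \<open>
  The infinite q-Pochhammer symbol \<open>(x; q)\<^sub>\<infinity> = \<Prod>k. (1 - x q^k)\<close>; the base \<open>q\<close> is the first argument.
\<close>
definition qpoch_inf :: "complex \<Rightarrow> complex \<Rightarrow> complex" where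
  "qpoch_inf q = dilation_prod (\<lambda>y. 1 - y) q"

text \<open>
  The double product \<open>\<Prod>j. \<Prod>k. (1 - x p^j q^k)\<close>.
\<close>
definition qpoch2_inf :: "complex \<Rightarrow> complex \<Rightarrow> complex \<Rightarrow> complex" where
  "qpoch2_inf p q = dilation_prod (qpoch_inf q) p"

lemma qpoch_inf_entire:
  assumes "norm q < 1"
  shows "qpoch_inf q holomorphic_on UNIV" "qpoch_inf q 0 = 1"
  unfolding qpoch_inf_def using assms
  by (auto intro!: holomorphic_dilation_prod dilation_prod_0 holomorphic_intros)

lemma qpoch_inf_eq_0_iff:
  assumes "norm q < 1"
  shows "qpoch_inf q x = 0 \<longleftrightarrow> (\<exists>k. x * q ^ k = 1)"
  unfolding qpoch_inf_def using assms
  by (subst dilation_prod_eq_0_iff) (auto intro!: holomorphic_intros)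

lemma qpoch_inf_step:
  assumes "norm q < 1"
  shows "qpoch_inf q x = (1 - x) * qpoch_inf q (x * q)"
  unfolding qpoch_inf_def using assms
  by (subst dilation_prod_step) (auto intro!: holomorphic_intros)

lemma qpoch2_inf_entire:
  assumes "norm p < 1" "norm q < 1"
  shows "qpoch2_inf p q holomorphic_on UNIV"
  unfolding qpoch2_inf_def using assms by (intro holomorphic_dilation_prod qpoch_inf_entire)

lemma qpoch2_inf_eq_0_iff:
  assumes "norm p < 1" "norm q < 1"
  shows "qpoch2_inf p q x = 0 \<longleftrightarrow> (\<exists>j k. x * p ^ j * q ^ k = 1)"
  unfolding qpoch2_inf_def using assms
  by (subst dilation_prod_eq_0_iff) (auto simp: qpoch_inf_entire qpoch_inf_eq_0_iff)

text \<open>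
  Passing from \<open>x\<close> to \<open>x q\<close> drops the factors with \<open>k = 0\<close>, and these make up \<open>(x; p)\<^sub>\<infinity>\<close>.
\<close>
lemma qpoch2_inf_step:
  assumes p: "norm p < 1" and q: "norm q < 1"
  shows "qpoch2_inf p q x = qpoch_inf p x * qpoch2_inf p q (x * q)"
proof -
  have "convergent_prod (\<lambda>j. 1 - x * p ^ j)"
    using p by (intro convergent_prod_dilation[where h = "\<lambda>y. 1 - y"] holomorphic_intros) auto
  moreover have "convergent_prod (\<lambda>j. qpoch_inf q (x * q * p ^ j))"
    by (intro convergent_prod_dilation qpoch_inf_entire p q)
  ultimately have "(\<Prod>j. 1 - x * p ^ j) * (\<Prod>j. qpoch_inf q (x * q * p ^ j))
      = (\<Prod>j. (1 - x * p ^ j) * qpoch_inf q (x * q * p ^ j))"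
    by (rule prodinf_mult)
  also have "\<dots> = (\<Prod>j. qpoch_inf q (x * p ^ j))"
    by (subst (2) qpoch_inf_step[OF q]) (simp add: mult_ac)
  finally show ?thesis
    by (simp add: qpoch2_inf_def qpoch_inf_def[of p] dilation_prod_def)
qed

section \<open>The elliptic gamma function as a quotient of entire functions\<close>

text \<open>
  The covering \<open>z \<mapsto> exp (2\<pi>iz)\<close> of the punctured plane, written in the form in which the factors of the
  elliptic gamma function are given.
\<close>
definition exp2pi :: "complex \<Rightarrow> complex" where
  "exp2pi z = exp (2 * of_real pi * \<i> * z)"

lemma exp2pi_add: "exp2pi (z + w) = exp2pi z * exp2pi w"
  by (simp add: exp2pi_def ring_distribs exp_add)

lemma exp2pi_of_nat_mult: "exp2pi (of_nat n * z) = exp2pi z ^ n"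
  by (simp add: exp2pi_def mult_ac flip: exp_of_nat_mult)

lemma exp2pi_periodic: "exp2pi (z + 1) = exp2pi z"
  by (simp add: exp2pi_add) (simp add: exp2pi_def)

lemma norm_exp2pi_less_1_iff: "norm (exp2pi z) < 1 \<longleftrightarrow> 0 < Im z"
  by (simp add: exp2pi_def zero_less_mult_iff)

lemma holomorphic_exp2pi [holomorphic_intros]:
  "f holomorphic_on A \<Longrightarrow> (\<lambda>z. exp2pi (f z)) holomorphic_on A"
  unfolding exp2pi_def by (intro holomorphic_intros)

locale elliptic_gamma_params =
  fixes \<tau> \<sigma> :: complex
  assumes Im_tau: "0 < Im \<tau>" and Im_sigma: "0 < Im \<sigma>"
begin

text \<open>
  The denominator of the elliptic gamma function. Its numerator is the reflection of \<open>D\<close> in the point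
  \<open>(\<tau> + \<sigma>) / 2\<close>.
\<close>
definition D :: "complex \<Rightarrow> complex" where
  "D z = qpoch2_inf (exp2pi \<tau>) (exp2pi \<sigma>) (exp2pi z)"

lemma norms: "norm (exp2pi \<tau>) < 1" "norm (exp2pi \<sigma>) < 1"
  using Im_tau Im_sigma by (simp_all add: norm_exp2pi_less_1_iff)

lemma D_entire: "D holomorphic_on UNIV"
  unfolding D_def
  by (rule holomorphic_on_compose_gen[OF _ qpoch2_inf_entire[OF norms], unfolded o_def])
    (auto intro!: holomorphic_intros)

lemma D_reflected_entire: "(\<lambda>z. D (\<tau> + \<sigma> - z)) holomorphic_on UNIV"
  by (rule holomorphic_on_compose_gen[OF _ D_entire, unfolded o_def])
    (auto intro!: holomorphic_intros)

lemma D_nonzero: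
  assumes z: "0 < Im z"
  shows "D z \<noteq> 0"
proof
  assume "D z = 0"
  then obtain j k where eq: "exp2pi z * exp2pi \<tau> ^ j * exp2pi \<sigma> ^ k = 1"
    unfolding D_def qpoch2_inf_eq_0_iff[OF norms] by blast
  have "norm (exp2pi (z + of_nat j * \<tau> + of_nat k * \<sigma>)) < 1"
    unfolding norm_exp2pi_less_1_iff using z Im_tau Im_sigma by (simp add: add_pos_nonneg)
  with eq show False
    by (simp add: exp2pi_add exp2pi_of_nat_mult)
qed

lemma D_periodic: "D (z + 1) = D z"
  by (simp add: D_def exp2pi_periodic)

lemma D_step: "D z = qpoch_inf (exp2pi \<tau>) (exp2pi z) * D (z + \<sigma>)"
  unfolding D_def exp2pi_add by (rule qpoch2_inf_step[OF norms])

text \<open>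
  The identity holds at every \<open>z\<close>, poles included: there a denominator factor vanishes, and by
  \<open>x / 0 = 0\<close> both sides are 0.
\<close>
lemma elliptic_gamma_eq: "elliptic_gamma z \<tau> \<sigma> = D (\<tau> + \<sigma> - z) / D z"
proof -
  define p q where "p = exp2pi \<tau>" and "q = exp2pi \<sigma>"
  have pq: "norm p < 1" "norm q < 1"
    using norms by (simp_all add: p_def q_def)
  define a b where "a = exp2pi (\<tau> + \<sigma> - z)" and "b = exp2pi z"
  have num: "exp (2 * of_real pi * \<i> * ((of_nat j + 1) * \<tau> + (of_nat k + 1) * \<sigma> - z))
      = a * p ^ j * q ^ k" for j k
  proof -
    have "(of_nat j + 1) * \<tau> + (of_nat k + 1) * \<sigma> - z
        = (\<tau> + \<sigma> - z) + of_nat j * \<tau> + of_nat k * \<sigma>"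
      by (simp add: algebra_simps)
    then show ?thesis
      unfolding a_def p_def q_def exp2pi_of_nat_mult[symmetric] exp2pi_add[symmetric]
      by (simp only: exp2pi_def)
  qed
  have den: "exp (2 * of_real pi * \<i> * (of_nat j * \<tau> + of_nat k * \<sigma> + z))
      = b * p ^ j * q ^ k" for j k
    unfolding b_def p_def q_def exp2pi_of_nat_mult[symmetric] exp2pi_add[symmetric]
    by (simp only: exp2pi_def add_ac)
  have conv1: "convergent_prod (\<lambda>k. 1 - y * q ^ k)" for y
    using pq by (intro convergent_prod_dilation[where h = "\<lambda>y. 1 - y"] holomorphic_intros) auto
  have conv2: "convergent_prod (\<lambda>j. qpoch_inf q (y * p ^ j))" for y
    by (intro convergent_prod_dilation qpoch_inf_entire pq)
  have "elliptic_gamma z \<tau> \<sigma>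
      = (\<Prod>j. \<Prod>k. (1 - a * p ^ j * q ^ k) / (1 - b * p ^ j * q ^ k))"
    unfolding elliptic_gamma_def num den ..
  also have "\<dots> = (\<Prod>j. qpoch_inf q (a * p ^ j) / qpoch_inf q (b * p ^ j))"
    by (simp add: qpoch_inf_def dilation_prod_def flip: prodinf_divide[OF conv1 conv1])
  also have "\<dots> = qpoch2_inf p q a / qpoch2_inf p q b"
    by (simp add: qpoch2_inf_def dilation_prod_def flip: prodinf_divide[OF conv2 conv2])
  finally show ?thesis
    by (simp add: D_def a_def b_def p_def q_def)
qed

lemma theta0_eq:
  "theta0 z \<tau> = qpoch_inf (exp2pi \<tau>) (exp2pi (\<tau> - z)) * qpoch_inf (exp2pi \<tau>) (exp2pi z)"
proof -
  define p where "p = exp2pi \<tau>"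
  have p: "norm p < 1"
    using norms by (simp add: p_def)
  have num: "exp (2 * of_real pi * \<i> * ((of_nat j + 1) * \<tau> - z)) = exp2pi (\<tau> - z) * p ^ j" for j
  proof -
    have "(of_nat j + 1) * \<tau> - z = (\<tau> - z) + of_nat j * \<tau>"
      by (simp add: algebra_simps)
    then show ?thesis
      unfolding p_def exp2pi_of_nat_mult[symmetric] exp2pi_add[symmetric]
      by (simp only: exp2pi_def)
  qed
  have den: "exp (2 * of_real pi * \<i> * (of_nat j * \<tau> + z)) = exp2pi z * p ^ j" for j
    unfolding p_def exp2pi_of_nat_mult[symmetric] exp2pi_add[symmetric]
    by (simp only: exp2pi_def add_ac)
  have conv: "convergent_prod (\<lambda>k. 1 - y * p ^ k)" for y
    using p by (intro convergent_prod_dilation[where h = "\<lambda>y. 1 - y"] holomorphic_intros) auto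
  show ?thesis
    unfolding theta0_def num den
    by (simp add: p_def[symmetric] qpoch_inf_def dilation_prod_def flip: prodinf_mult[OF conv conv])
qed

abbreviation G :: "complex \<Rightarrow> complex" where
  "G z \<equiv> elliptic_gamma z \<tau> \<sigma>"

lemma G_analytic_at: "D z \<noteq> 0 \<Longrightarrow> G analytic_on {z}"
  unfolding elliptic_gamma_eq
  using D_entire D_reflected_entire
  by (intro analytic_on_divide) (auto simp: analytic_on_holomorphic)

text \<open>
  No zero of \<open>D\<close> is cancelled: \<open>D z = 0\<close> forces \<open>Im z \<le> 0\<close>, so \<open>\<tau> + \<sigma> - z\<close> lies in the upper half plane,
  where \<open>D\<close> does not vanish.
\<close>
lemma G_pole:
  assumes z: "D z = 0"
  shows "is_pole G z"
proof -
  have "D \<tau> \<noteq> 0"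
    using D_nonzero Im_tau by blast
  then have "\<forall>\<^sub>F w in at z. D w \<noteq> 0"
    using non_zero_neighbour_alt[OF D_entire, of z \<tau>] by (auto elim: eventually_mono)
  moreover have "isCont D z"
    using D_entire by (meson analytic_at_imp_isCont analytic_on_holomorphic open_UNIV subset_UNIV)
  ultimately have "filterlim D (at 0) (at z)"
    using z by (simp add: filterlim_at isCont_def)
  moreover have "isCont (\<lambda>z. D (\<tau> + \<sigma> - z)) z"
    using D_reflected_entire
    by (meson analytic_at_imp_isCont analytic_on_holomorphic open_UNIV subset_UNIV)
  moreover have "D (\<tau> + \<sigma> - z) \<noteq> 0"
  proof -
    have "Im z \<le> 0"
      using D_nonzero[of z] z by linarith
    then show ?thesis
      using Im_tau Im_sigma by (intro D_nonzero) simp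
  qed
  ultimately show ?thesis
    unfolding elliptic_gamma_eq by (intro is_pole_divide)
qed

lemma G_nicely_meromorphic: "G nicely_meromorphic_on UNIV"
  unfolding nicely_meromorphic_on_def
proof (intro conjI ballI)
  show "G meromorphic_on UNIV"
    unfolding elliptic_gamma_eq
    by (intro meromorphic_intros analytic_on_imp_meromorphic_on)
      (use D_entire D_reflected_entire in \<open>auto simp: analytic_on_open\<close>)
  show "is_pole G z \<and> G z = 0 \<or> G \<midarrow>z\<rightarrow> G z" for z
  proof (cases "D z = 0")
    case True
    then show ?thesis
      using G_pole by (simp add: elliptic_gamma_eq)
  next
    case False
    then show ?thesis
      using G_analytic_at analytic_at_imp_isCont isContD by blast
  qed
qed

lemma G_step:
  assumes "D z \<noteq> 0"
  shows "G (z + \<sigma>) = theta0 z \<tau> * G z"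
proof -
  have "D (\<tau> - z) = qpoch_inf (exp2pi \<tau>) (exp2pi (\<tau> - z)) * D (\<tau> + \<sigma> - z)"
    using D_step[of "\<tau> - z"] by (simp add: algebra_simps)
  moreover have "qpoch_inf (exp2pi \<tau>) (exp2pi z) \<noteq> 0" "D (z + \<sigma>) \<noteq> 0"
    using assms D_step[of z] by auto
  ultimately show ?thesis
    unfolding elliptic_gamma_eq theta0_eq
    by (subst D_step[of z]) (simp add: algebra_simps)
qed

lemma G_solution: "difference_equation_solution \<tau> \<sigma> G"
  unfolding difference_equation_solution_def
  using G_nicely_meromorphic G_step G_pole by blast

lemma G_periodic: "G (z + 1) = G z"
proof -
  have "D (\<tau> + \<sigma> - (z + 1)) = D (\<tau> + \<sigma> - z)"
    using D_periodic[of "\<tau> + \<sigma> - (z + 1)"] by (simp add: algebra_simps)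
  then show ?thesis
    by (simp add: elliptic_gamma_eq D_periodic)
qed

lemma G_holomorphic: "G holomorphic_on {z. Im z > 0}"
proof -
  have "G analytic_on {z. Im z > 0}"
    using G_analytic_at D_nonzero analytic_on_analytic_at by blast
  then show ?thesis
    by (rule analytic_imp_holomorphic)
qed

lemma G_nonzero: "0 < Im z \<Longrightarrow> Im z < Im \<tau> + Im \<sigma> \<Longrightarrow> G z \<noteq> 0"
  unfolding elliptic_gamma_eq using D_nonzero by simp

lemma G_midpoint: "G ((\<tau> + \<sigma>) / 2) = 1"
proof -
  have "\<tau> + \<sigma> - (\<tau> + \<sigma>) / 2 = (\<tau> + \<sigma>) / 2"
    by (simp add: field_simps)
  moreover have "D ((\<tau> + \<sigma>) / 2) \<noteq> 0"
    using Im_tau Im_sigma by (intro D_nonzero) simp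
  ultimately show ?thesis
    unfolding elliptic_gamma_eq by (metis divide_self)
qed

end

section \<open>Uniqueness\<close>

text \<open>
  A Liouville-type statement for functions with periods \<open>1\<close> and \<open>\<sigma>\<close> that are only given on a horizontal
  strip. The strip is higher than \<open>Im \<sigma>\<close> by \<open>t\<close>, and \<open>per2\<close> covers exactly the \<open>z\<close> for which \<open>z\<close> and
  \<open>z + \<sigma>\<close> both lie in it.
\<close>
lemma strip_constant:
  fixes f :: "complex \<Rightarrow> complex" and \<sigma> :: complex
  assumes \<sigma>: "0 < Im \<sigma>" and t: "0 < t"
    and f: "f holomorphic_on {z. 0 < Im z \<and> Im z < t + Im \<sigma>}"
    and per1: "\<And>z. 0 < Im z \<Longrightarrow> Im z < t + Im \<sigma> \<Longrightarrow> f (z + 1) = f z"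
    and per2: "\<And>z. 0 < Im z \<Longrightarrow> Im z < t \<Longrightarrow> f (z + \<sigma>) = f z"
  shows "f constant_on {z. 0 < Im z \<and> Im z < t + Im \<sigma>}"
proof -
  define S where "S = {z. 0 < Im z \<and> Im z < t + Im \<sigma>}"
  have S: "open S" "connected S"
  proof -
    have S_eq: "S = {z. 0 < Im z} \<inter> {z. Im z < t + Im \<sigma>}"
      by (auto simp: S_def)
    show "open S"
      unfolding S_eq by (intro open_Int open_halfspace_Im_gt open_halfspace_Im_lt)
    show "connected S"
      unfolding S_eq
      by (intro convex_connected convex_Int convex_halfspace_Im_gt convex_halfspace_Im_lt)
  qed
  have per1_nat: "f (z + of_nat n) = f z" if "z \<in> S" for z n
    using that
  proof (induction n)
    case (Suc n)
    then show ?case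
      using per1[of "z + of_nat n"] by (simp add: S_def add_ac)
  qed simp
  have per1_int: "f (z + of_int n) = f z" if z: "z \<in> S" for z n
  proof (cases "0 \<le> n")
    case True
    then show ?thesis
      using per1_nat[OF z, of "nat n"] by simp
  next
    case False
    then show ?thesis
      using per1_nat[of "z + of_int n" "nat (- n)"] z by (simp add: S_def)
  qed
  \<comment> \<open>The middle part \<open>a \<le> Im z \<le> a + Im \<sigma>\<close> of the strip has height \<open>Im \<sigma>\<close> and is separated from both
    edges; modulo the period 1 it is the compact rectangle \<open>K\<close>.\<close>
  define a where "a = t / 2"
  define K where "K = cbox (Complex 0 a) (Complex 1 (a + Im \<sigma>))"
  have K_iff: "z \<in> K \<longleftrightarrow> 0 \<le> Re z \<and> Re z \<le> 1 \<and> a \<le> Im z \<and> Im z \<le> a + Im \<sigma>" for z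
    by (auto simp: K_def in_cbox_complex_iff)
  have "K \<subseteq> S"
    using t by (auto simp: K_iff S_def a_def)
  then have "f holomorphic_on K"
    using f holomorphic_on_subset unfolding S_def by blast
  then have "continuous_on K (\<lambda>z. norm (f z))"
    by (rule continuous_on_norm[OF holomorphic_on_imp_continuous_on])
  moreover have "Complex 0 a \<in> K"
    using \<sigma> by (simp add: K_iff)
  ultimately obtain w where w: "w \<in> K" and w_max: "\<And>z. z \<in> K \<Longrightarrow> norm (f z) \<le> norm (f w)"
    using continuous_attains_sup[of K "\<lambda>z. norm (f z)"] compact_cbox
    unfolding K_def by blast
  have bound: "norm (f z) \<le> norm (f w)" if z: "a \<le> Im z" "Im z \<le> a + Im \<sigma>" for z
  proof -
    have "z \<in> S"
      using z t by (auto simp: S_def a_def)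
    then have "f (z + of_int (- \<lfloor>Re z\<rfloor>)) = f z"
      by (rule per1_int)
    moreover have "z + of_int (- \<lfloor>Re z\<rfloor>) \<in> K"
      using z by (simp add: K_iff) linarith
    ultimately show ?thesis
      using w_max by metis
  qed
  \<comment> \<open>The maximum may be attained on the edge of the middle part. The period \<open>\<sigma>\<close> moves points within
    distance \<open>r\<close> of that part back into it, so the bound holds on a full disc around \<open>w\<close>.\<close>
  define r where "r = min a (Im \<sigma>)"
  have r: "0 < r" "r \<le> a" "r \<le> Im \<sigma>"
    using t \<sigma> by (auto simp: r_def a_def)
  have near: "norm (f z) \<le> norm (f w)" if z: "a - r < Im z" "Im z < a + Im \<sigma> + r" for z
  proof -
    consider "Im z < a" | "a \<le> Im z" "Im z \<le> a + Im \<sigma>" | "a + Im \<sigma> < Im z"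
      by linarith
    then show ?thesis
    proof cases
      case 1
      then have "f (z + \<sigma>) = f z"
        using z r t by (intro per2) (auto simp: a_def)
      moreover have "norm (f (z + \<sigma>)) \<le> norm (f w)"
        using 1 z r by (intro bound) auto
      ultimately show ?thesis
        by simp
    next
      case 2
      then show ?thesis
        by (rule bound)
    next
      case 3
      then have "f (z - \<sigma> + \<sigma>) = f (z - \<sigma>)"
        using z r t by (intro per2) (auto simp: a_def)
      moreover have "norm (f (z - \<sigma>)) \<le> norm (f w)"
        using 3 z r by (intro bound) auto
      ultimately show ?thesis
        by simp
    qed
  qed
  have ball: "a - r < Im z \<and> Im z < a + Im \<sigma> + r" if "z \<in> ball w r" for z
  proof -
    have "\<bar>Im (w - z)\<bar> < r"
      using that abs_Im_le_cmod[of "w - z"] by (simp add: dist_norm)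
    then show ?thesis
      using w by (auto simp: K_iff)
  qed
  have "ball w r \<subseteq> S"
    using ball r t by (fastforce simp: S_def a_def)
  then have "f constant_on S"
    using maximum_modulus_principle[of f S "ball w r" w] f S r near ball unfolding S_def by auto
  then show ?thesis
    by (simp add: S_def)
qed

text \<open>
  The identity theorem for meromorphic functions. Equality holds also at the poles because a nicely
  meromorphic function takes the value 0 there.
\<close>
lemma nicely_meromorphic_eqI:
  assumes f: "f nicely_meromorphic_on A" and g: "g nicely_meromorphic_on A"
    and A: "open A" "connected A" and z0: "z0 \<in> A"
    and eq: "frequently (\<lambda>z. f z = g z) (at z0)"
    and z: "z \<in> A"
  shows "f z = g z"
proof -
  have "(\<lambda>z. f z - g z) meromorphic_on A"
    using f g by (auto simp: nicely_meromorphic_on_def intro: meromorphic_intros)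
  from meromorphic_imp_constant_or_avoid[OF this A, of 0]
  have "eventually (\<lambda>z. f z = g z) (at z)"
    using eq z z0 A by (auto simp: eventually_cosparse_open_eq frequently_def)
  then have pole: "is_pole f z \<longleftrightarrow> is_pole g z"
    and lim: "(f \<midarrow>z\<rightarrow> c) \<longleftrightarrow> (g \<midarrow>z\<rightarrow> c)" for c
    by (auto intro!: is_pole_cong tendsto_cong)
  show ?thesis
  proof (cases "is_pole f z")
    case True
    then have "f z = 0" "g z = 0"
      using f g z pole
      by (meson at_neq_bot is_pole_def nicely_meromorphic_on_def
          not_tendsto_and_filterlim_at_infinity)+
    then show ?thesis
      by simp
  next
    case False
    then have "f \<midarrow>z\<rightarrow> f z" "g \<midarrow>z\<rightarrow> g z"
      using f g z pole by (auto simp: nicely_meromorphic_on_def)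
    then show ?thesis
      using lim LIM_unique by blast
  qed
qed

context elliptic_gamma_params
begin

lemma solution_unique:
  assumes u: "difference_equation_solution \<tau> \<sigma> u"
    and per: "\<And>z. u (z + 1) = u z"
    and hol: "u holomorphic_on {z. Im z > 0}"
    and mid: "u ((\<tau> + \<sigma>) / 2) = 1"
  shows "u = G"
proof
  fix z
  define S where "S = {z. 0 < Im z \<and> Im z < Im \<tau> + Im \<sigma>}"
  define f where "f = (\<lambda>z. u z / G z)"
  have u_step: "u (z + \<sigma>) = theta0 z \<tau> * u z" if "0 < Im z" for z
  proof -
    have "\<not> is_pole u z"
      using hol that by (intro not_is_pole_holomorphic[OF open_halfspace_Im_gt[of 0]]) auto
    then show ?thesis
      using u by (auto simp: difference_equation_solution_def)
  qed
  have "f constant_on S"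
    unfolding S_def
  proof (rule strip_constant[OF Im_sigma Im_tau])
    show "f holomorphic_on {z. 0 < Im z \<and> Im z < Im \<tau> + Im \<sigma>}"
      unfolding f_def using hol G_holomorphic
      by (intro holomorphic_on_divide) (auto intro: holomorphic_on_subset G_nonzero simp: G_nonzero)
    show "f (z + 1) = f z" for z
      by (simp add: f_def per G_periodic)
    show "f (z + \<sigma>) = f z" if z: "0 < Im z" "Im z < Im \<tau>" for z
    proof -
      have "G (z + \<sigma>) = theta0 z \<tau> * G z"
        using z by (intro G_step D_nonzero)
      \<comment> \<open>This also shows \<open>theta0 z \<tau> \<noteq> 0\<close>, so the factor cancels in the quotient.\<close>
      moreover have "G (z + \<sigma>) \<noteq> 0"
        using z Im_sigma by (intro G_nonzero) auto
      ultimately show ?thesis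
        using u_step[of z] z by (auto simp: f_def)
    qed
  qed
  moreover have mid_in: "(\<tau> + \<sigma>) / 2 \<in> S"
    using Im_tau Im_sigma by (simp add: S_def)
  moreover have "f ((\<tau> + \<sigma>) / 2) = 1"
    by (simp add: f_def mid G_midpoint)
  ultimately have "f w = 1" if "w \<in> S" for w
    using that unfolding constant_on_def by metis
  then have eq: "u w = G w" if "w \<in> S" for w
    using that G_nonzero[of w] by (simp add: f_def S_def)
  have "open S"
    unfolding S_def Collect_conj_eq by (intro open_Int open_halfspace_Im_gt open_halfspace_Im_lt)
  then have "eventually (\<lambda>w. w \<in> S) (at ((\<tau> + \<sigma>) / 2))"
    using mid_in by (rule eventually_at_in_open')
  then have "eventually (\<lambda>w. u w = G w) (at ((\<tau> + \<sigma>) / 2))"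
    by eventually_elim (rule eq)
  then have "frequently (\<lambda>w. u w = G w) (at ((\<tau> + \<sigma>) / 2))"
    by (intro eventually_frequently) auto
  then show "u z = G z"
    using u G_nicely_meromorphic
    by (intro nicely_meromorphic_eqI[of u UNIV G "(\<tau> + \<sigma>) / 2"])
      (auto simp: difference_equation_solution_def)
qed

end

theorem theorem1p1:
  fixes \<tau> \<sigma> :: complex
  assumes "Im \<tau> > 0" and "Im \<sigma> > 0"
  shows "\<forall>u :: complex \<Rightarrow> complex.
    (difference_equation_solution \<tau> \<sigma> u \<and>
     (\<forall>z. u (z + 1) = u z) \<and>
     u holomorphic_on {z. Im z > 0} \<and>
     u ((\<tau> + \<sigma>) / 2) = 1)
    \<longleftrightarrow> u = (\<lambda>z. elliptic_gamma z \<tau> \<sigma>)"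
proof -
  interpret elliptic_gamma_params \<tau> \<sigma>
    using assms by unfold_locales
  show ?thesis
    using solution_unique G_solution G_periodic G_holomorphic G_midpoint by blast
qed

end
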